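(* Let $S$ be a countable set and let $G$ be a semigroup acting on $S$. Let $X$ be a second countable compact space. Let $E:S\rightarrow X$ be given, and let $\{I_n\}$ be a F{\o}lner sequence of subsets of $G$. Then there are a dynamical system $(Y,\mathcal{B},\nu,(T_g)_{g\in G})$ and measurable functions (with respect to the Borel sets generated by the topology on $X$) $\tilde E_s:Y\rightarrow X$ for each $s\in S$ such that the following hold: (1) For any $g\in G$ and $s\in S$, $\tilde E_{gs}=\tilde E_s\circ T_g$. (2) For any integer $k$, any continuous function $u:X^k\rightarrow\mathbb{R}$, and any finite sequence $s_1,\ldots,s_k$ of elements of $S$, $$\liminf_{n\rightarrow\infty}\frac{1}{|I_n|}\sum_{g\in I_n}u(E(gs_1),\ldots,E(gs_k))\leq\int u(\tilde E_{s_1},\ldots,\tilde E_{s_k})\,d\nu\leq\limsup_{n\rightarrow\infty}\frac{1}{|I_n|}\sum_{g\in I_n}u(E(gs_1),\ldots,E(gs_k)).$$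
   Context: The action of $g\in G$ on $s\in S$ is written $gs$. Let $G$ be a semigroup and let $\{I_n\}$ be a sequence of finite subsets of $G$. The sequence $\{I_n\}$ is a (left) F{\o}lner sequence if for each $g\in G$ and each $\epsilon>0$ there is some $M_{g,\epsilon}$ such that whenever $n\geq M_{g,\epsilon}$, $\frac{|I_n\bigtriangleup g\cdot I_n|}{|I_n|}<\epsilon$, where $g\cdot I_n=\{gh\mid h\in I_n\}$. A dynamical system $(Y,\mathcal{B},\nu,(T_g)_{g\in G})$ is a measure space $(Y,\mathcal{B},\nu)$ together with a collection of measurable, measure-preserving transformations $T_g:Y\rightarrow Y$ indexed by the semigroup $G$ such that $T_g\circ T_h=T_{gh}$.
   Formalization: The action of G on S is taken to satisfy g(hs) = (hg)s; with g(hs) = (gh)s the claim fails for noncommutative G (finite nonabelian G, S = X = I_n = G, E = id), since (1) and T_g∘T_h = T_{gh} force Ẽ_{gh} = Ẽ_{hg}. For commutative G the two laws coincide. *)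

theory Defs
  imports "HOL-Analysis.Analysis"
begin

text \<open>
  The composition law is \<open>g (h s) = (h g) s\<close>. It is forced by the conventions
  \<open>T\<^sub>g \<circ> T\<^sub>h = T\<^sub>g\<^sub>h\<close> and \<open>E\<^sub>g\<^sub>s = E\<^sub>s \<circ> T\<^sub>g\<close>, which give
  \<open>E\<^sub>g\<^sub>(\<^sub>h\<^sub>s\<^sub>) = E\<^sub>h\<^sub>s \<circ> T\<^sub>g = E\<^sub>s \<circ> T\<^sub>h \<circ> T\<^sub>g = E\<^sub>(\<^sub>h\<^sub>g\<^sub>)\<^sub>s\<close>, and it is also the law for which
  a left Folner sequence yields invariant averages. With \<open>g (h s) = (g h) s\<close> the
  correspondence fails for noncommutative \<open>G\<close>: take \<open>G\<close> a finite nonabelian group,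
  \<open>S = X = I\<^sub>n = G\<close>, \<open>E\<close> the identity and \<open>u\<close> the indicator of the diagonal. For commutative
  \<open>G\<close> the two laws coincide.
\<close>

definition semigroup_acts_on :: "('g::semigroup_mult \<Rightarrow> 's \<Rightarrow> 's) \<Rightarrow> 's set \<Rightarrow> bool" where
  "semigroup_acts_on act S \<longleftrightarrow>
     (\<forall>g. \<forall>s\<in>S. act g s \<in> S) \<and>
     (\<forall>g h. \<forall>s\<in>S. act g (act h s) = act (h * g) s)"

text \<open>
  Nonemptiness of \<open>I n\<close> is demanded only where the quotient is used; without it the
  convention \<open>x / 0 = 0\<close> would admit empty sets.
\<close>

definition folner_sequence :: "(nat \<Rightarrow> 'g::semigroup_mult set) \<Rightarrow> bool" where
  "folner_sequence I \<longleftrightarrow>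
     (\<forall>n. finite (I n)) \<and>
     (\<forall>g. \<forall>\<epsilon>>0. \<exists>M. \<forall>n\<ge>M. I n \<noteq> {} \<and>
        real (card (sym_diff (I n) ((\<lambda>h. g * h) ` I n))) / real (card (I n)) < \<epsilon>)"

definition dynamical_system :: "'y measure \<Rightarrow> ('g::semigroup_mult \<Rightarrow> 'y \<Rightarrow> 'y) \<Rightarrow> bool" where
  "dynamical_system \<nu> T \<longleftrightarrow>
     (\<forall>g. T g \<in> measurable \<nu> \<nu> \<and> distr \<nu> \<nu> (T g) = \<nu>) \<and>
     (\<forall>g h. \<forall>y\<in>space \<nu>. T g (T h y) = T (g * h) y)"

text \<open>
  A point of \<open>X\<^sup>k\<close> is an extensional function on \<open>{..<k}\<close>.
\<close>

definition orbit_average ::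
  "('g \<Rightarrow> 's \<Rightarrow> 's) \<Rightarrow> ('s \<Rightarrow> 'x) \<Rightarrow> 'g set \<Rightarrow> nat \<Rightarrow> ((nat \<Rightarrow> 'x) \<Rightarrow> real) \<Rightarrow> (nat \<Rightarrow> 's) \<Rightarrow> real" where
  "orbit_average act E F k u s =
     (1 / real (card F)) * (\<Sum>g\<in>F. u (\<lambda>i\<in>{..<k}. E (act g (s i))))"

end

(* Fix a countable base U of X and record a point x by its code n |-> [x in U n]. The orbit points
   omega_h(s, n) = [E (h s) in U n] lie in the compact cube of boolean functions on 's * nat, and by
   Tychonoff their empirical measures over I n converge on all clopen sets along one filter finer than
   sequentially. The limit is a finitely additive set function on clopen sets; compactness makes it
   countably additive, so it extends to a measure, and the Folner condition makes it invariant under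
   the coordinate maps induced by G. The result is transported to functions S -> X by a measurable
   decoding of codes. X need not be Hausdorff, so decode is not a left inverse of code; but every
   neighbourhood of decode (code x) contains x, and continuous real functions cannot see the difference. *)

theory Submission
  imports Defs
begin

section \<open>Measures as limits of empirical measures\<close>

lemma Liminf_antimono_filter: "F \<le> F' \<Longrightarrow> Liminf F' f \<le> Liminf F f"
  unfolding Liminf_def by (intro SUP_subset_mono) (auto simp: le_filter_def)

lemma Limsup_mono_filter: "F \<le> F' \<Longrightarrow> Limsup F f \<le> Limsup F' f"
  unfolding Limsup_def by (intro INF_superset_mono) (auto simp: le_filter_def)

lemma cluster_filter:
  fixes f :: "nat \<Rightarrow> 'a \<Rightarrow> real"
  assumes "\<And>n a. f n a \<in> {0..1}"
  shows "\<exists>G m. G \<noteq> bot \<and> G \<le> sequentially \<and> (\<forall>a. ((\<lambda>n. f n a) \<longlongrightarrow> m a) G)"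
proof -
  let ?K = "PiE UNIV (\<lambda>_::'a. {0..1::real})"
  have "compactin (product_topology (\<lambda>_. euclidean) UNIV) ?K"
    by (simp add: compactin_PiE)
  then have K: "compact ?K"
    by (simp add: euclidean_product_topology)
  have "filtermap f sequentially \<noteq> bot"
    by (simp add: filtermap_bot_iff)
  moreover have "\<forall>\<^sub>F x in filtermap f sequentially. x \<in> ?K"
    using assms by (auto simp: eventually_filtermap PiE_iff intro!: always_eventually)
  ultimately obtain m where m: "inf (nhds m) (filtermap f sequentially) \<noteq> bot"
    using K[unfolded compact_filter] by blast
  \<comment> \<open>\<open>G\<close> adds to \<open>sequentially\<close> the pulled-back
    neighbourhoods of the cluster point \<open>m\<close>. It is proper, since otherwise some
    neighbourhood of \<open>m\<close> would miss a tail of \<open>f\<close>.\<close>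
  define G where "G = inf sequentially (filtercomap f (nhds m))"
  have "G \<noteq> bot"
  proof
    assume "G = bot"
    then have "\<forall>\<^sub>F n in inf sequentially (filtercomap f (nhds m)). False"
      by (simp add: G_def)
    then obtain P Q where PQ: "eventually P sequentially" "eventually Q (nhds m)" "\<And>n. P n \<Longrightarrow> Q (f n) \<Longrightarrow> False"
      unfolding eventually_inf eventually_filtercomap by (metis (no_types, lifting))
    have "\<forall>\<^sub>F x in inf (nhds m) (filtermap f sequentially). False"
      unfolding eventually_inf eventually_filtermap
      by (rule exI[of _ Q], rule exI[of _ "\<lambda>x. \<not> Q x"])
         (use PQ(2,3) eventually_mono[OF PQ(1), of "\<lambda>n. \<not> Q (f n)"] in auto)
    with m show False
      by (simp add: trivial_limit_def)
  qed
  moreover have "G \<le> sequentially"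
    by (simp add: G_def)
  moreover have "((\<lambda>n. f n a) \<longlongrightarrow> m a) G" for a
  proof -
    have f: "(f \<longlongrightarrow> m) G"
      unfolding G_def by (meson filterlim_filtercomap filterlim_mono inf_le2 order_refl)
    have "continuous_on UNIV (\<lambda>x::'a\<Rightarrow>real. x a)"
      by simp
    from continuous_on_tendsto_compose[OF this f] show ?thesis by simp
  qed
  ultimately show ?thesis by blast
qed

section \<open>Contents on clopen sets and their extension to measures\<close>

abbreviation clopens :: "'a::topological_space set set" where
  "clopens \<equiv> {A. open A \<and> closed A}"

lemma algebra_clopens: "algebra UNIV clopens"
  by (auto simp: algebra_iff_Un)

text \<open>By compactness a decreasing sequence of clopen sets with empty intersection reaches
  \<open>{}\<close>, so the continuity at \<open>{}\<close> demanded by Caratheodory's theorem is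
  automatic.\<close>

lemma clopen_content_extends:
  fixes m :: "'a::topological_space set \<Rightarrow> real"
  assumes cpt: "compact (UNIV :: 'a set)"
    and nonneg: "\<And>A. A \<in> clopens \<Longrightarrow> 0 \<le> m A"
    and add: "\<And>A B. A \<in> clopens \<Longrightarrow> B \<in> clopens \<Longrightarrow> A \<inter> B = {} \<Longrightarrow> m (A \<union> B) = m A + m B"
  obtains \<mu> where "space \<mu> = UNIV" "sets \<mu> = sigma_sets UNIV clopens"
    "\<And>A. A \<in> clopens \<Longrightarrow> emeasure \<mu> A = ennreal (m A)"
proof -
  interpret algebra UNIV "clopens :: 'a set set"
    by (rule algebra_clopens)
  have m0: "m {} = 0"
    using add[of "{}" "{}"] by simp
  let ?f = "\<lambda>A. ennreal (m A)"
  have "\<exists>\<mu> :: 'a set \<Rightarrow> ennreal. (\<forall>s \<in> clopens. \<mu> s = ?f s) \<and> measure_space UNIV (sigma_sets UNIV clopens) \<mu>"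
  proof (rule caratheodory_empty_continuous)
    show "positive clopens ?f"
      by (simp add: positive_def m0)
    show "additive clopens ?f"
      unfolding additive_def using add nonneg by (auto simp: ennreal_plus[symmetric] simp del: ennreal_plus)
    fix A :: "nat \<Rightarrow> 'a set"
    assume A: "range A \<subseteq> clopens" "decseq A" "(\<Inter>i. A i) = {}"
    have "\<exists>N. A N = {}"
    proof (rule ccontr)
      assume ne: "\<nexists>N. A N = {}"
      have "UNIV \<inter> (\<Inter>i\<in>UNIV. A i) \<noteq> {}"
      proof (rule compact_imp_fip_image[OF cpt])
        show "closed (A i)" for i using A(1) by auto
        fix J :: "nat set" assume "finite J"
        then obtain N where "\<forall>j\<in>J. j \<le> N"
          by (meson finite_nat_set_iff_bounded_le)
        then have "A N \<subseteq> (\<Inter>i\<in>J. A i)"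
          using A(2) by (auto simp: decseq_def)
        then show "UNIV \<inter> (\<Inter>i\<in>J. A i) \<noteq> {}"
          using ne by auto
      qed
      then show False using A(3) by simp
    qed
    then obtain N where "A N = {}" by blast
    then have "A n = {}" if "n \<ge> N" for n
      using A(2) that by (metis decseqD subset_empty)
    then have "\<forall>\<^sub>F n in sequentially. ?f (A n) = 0"
      using m0 by (auto simp: eventually_sequentially intro!: exI[of _ N])
    then show "(\<lambda>i. ?f (A i)) \<longlonglongrightarrow> 0"
      by (rule tendsto_eventually)
  qed simp
  then obtain \<mu> where \<mu>: "\<And>s. s \<in> clopens \<Longrightarrow> \<mu> s = ?f s" "measure_space UNIV (sigma_sets UNIV clopens) \<mu>"
    by blast
  let ?M = "measure_of UNIV clopens \<mu>"
  have "emeasure ?M A = ?f A" if "A \<in> clopens" for A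
    using that \<mu> by (subst emeasure_measure_of[OF refl]) (auto simp: measure_space_def)
  then show thesis
    by (intro that[of ?M]) (auto simp: space_measure_of sets_measure_of)
qed

text \<open>The limit \<open>m\<close> is formed over all subsets at once and is finitely additive
  there; only its restriction to clopen sets is extended to a measure.\<close>

lemma empirical_measures_cluster:
  fixes \<omega> :: "'g \<Rightarrow> 'a::topological_space" and I :: "nat \<Rightarrow> 'g set"
  assumes cpt: "compact (UNIV :: 'a set)"
    and fin: "\<And>n. finite (I n)"
    and ne: "\<forall>\<^sub>F n in sequentially. I n \<noteq> {}"
  obtains \<mu> :: "'a measure" and G :: "nat filter"
  where "space \<mu> = UNIV" "sets \<mu> = sigma_sets UNIV clopens" "emeasure \<mu> UNIV = 1"
    "G \<noteq> bot" "G \<le> sequentially"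
    "\<And>A. A \<in> clopens \<Longrightarrow> ((\<lambda>n. real (card {g\<in>I n. \<omega> g \<in> A}) / real (card (I n))) \<longlongrightarrow> measure \<mu> A) G"
proof -
  let ?f = "\<lambda>n A. real (card {g\<in>I n. \<omega> g \<in> A}) / real (card (I n))"
  have f01: "?f n A \<in> {0..1}" for n A
    by (auto simp: divide_le_eq_1 intro!: card_mono fin)
  obtain G m where G: "G \<noteq> bot" "G \<le> sequentially" and m: "\<And>A. ((\<lambda>n. ?f n A) \<longlongrightarrow> m A) G"
    using cluster_filter[of ?f, OF f01] by blast
  have nonneg: "0 \<le> m A" for A
    by (rule tendsto_lowerbound[OF m _ G(1)]) simp
  have add: "m (A \<union> B) = m A + m B" if "A \<inter> B = {}" for A B
  proof -
    have "{g\<in>I n. \<omega> g \<in> A \<union> B} = {g\<in>I n. \<omega> g \<in> A} \<union> {g\<in>I n. \<omega> g \<in> B}" for n by auto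
    moreover have "{g\<in>I n. \<omega> g \<in> A} \<inter> {g\<in>I n. \<omega> g \<in> B} = {}" for n using that by auto
    ultimately have "?f n (A \<union> B) = ?f n A + ?f n B" for n
      by (simp add: card_Un_disjoint fin add_divide_distrib)
    then have "((\<lambda>n. ?f n (A \<union> B)) \<longlongrightarrow> m A + m B) G"
      by (simp only:) (intro tendsto_add m)
    then show ?thesis
      using tendsto_unique[OF G(1) m] by blast
  qed
  \<comment> \<open>An empty \<open>I n\<close> would contribute \<open>0 / 0 = 0\<close>; total
    mass one rests on eventual nonemptiness.\<close>
  have "\<forall>\<^sub>F n in G. ?f n UNIV = 1"
    using filter_leD[OF G(2) ne] by eventually_elim (simp add: fin)
  then have "((\<lambda>n. ?f n UNIV) \<longlongrightarrow> 1) G"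
    by (rule tendsto_eventually)
  then have one: "m UNIV = 1"
    using tendsto_unique[OF G(1) m] by blast
  obtain \<mu> where \<mu>: "space \<mu> = UNIV" "sets \<mu> = sigma_sets UNIV clopens"
    "\<And>A. A \<in> clopens \<Longrightarrow> emeasure \<mu> A = ennreal (m A)"
    using clopen_content_extends[OF cpt nonneg add] by blast
  show thesis
    by (rule that[OF \<mu>(1,2) _ G]) (simp_all add: \<mu>(3) m one nonneg measure_def)
qed

section \<open>Convergence of averages to integrals\<close>

lemma average_diff_le:
  fixes f h :: "'g \<Rightarrow> real"
  assumes "\<And>g. g \<in> F \<Longrightarrow> \<bar>f g - h g\<bar> \<le> e" "0 \<le> e"
  shows "\<bar>1 / real (card F) * (\<Sum>g\<in>F. f g) - 1 / real (card F) * (\<Sum>g\<in>F. h g)\<bar> \<le> e"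
proof (cases "card F = 0")
  case False
  have "\<bar>(\<Sum>g\<in>F. f g) - (\<Sum>g\<in>F. h g)\<bar> \<le> (\<Sum>g\<in>F. \<bar>f g - h g\<bar>)"
    by (simp add: sum_subtractf[symmetric])
  also have "\<dots> \<le> real (card F) * e"
    using sum_bounded_above[of F "\<lambda>g. \<bar>f g - h g\<bar>" e] assms by simp
  finally show ?thesis
    using False by (simp add: diff_divide_distrib[symmetric] field_simps)
qed (use assms in simp)

text \<open>On \<open>K\<close> the function is uniformly close to a step function over clopen
  pieces, for which \<open>conv\<close> gives the limit. The error stays small in the averages
  because \<open>\<omega> g\<close> lies in \<open>K\<close>, and in the integral because almost
  every point does. Nothing controls \<open>f\<close> off \<open>K\<close>, hence the separate
  measurability hypothesis.\<close>

lemma averages_tendsto_integral: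
  fixes \<omega> :: "'g \<Rightarrow> 'a::topological_space" and I :: "nat \<Rightarrow> 'g set" and f :: "'a \<Rightarrow> real"
  assumes cpt: "compact (UNIV :: 'a set)"
    and fin: "\<And>n. finite (I n)"
    and \<mu>: "clopens \<subseteq> sets \<mu>" "emeasure \<mu> UNIV = 1"
    and conv: "\<And>A. A \<in> clopens \<Longrightarrow> ((\<lambda>n. real (card {g\<in>I n. \<omega> g \<in> A}) / real (card (I n))) \<longlongrightarrow> measure \<mu> A) G"
    and K: "closed K" "\<And>g. \<omega> g \<in> K" "AE y in \<mu>. y \<in> K"
    and meas: "f \<in> borel_measurable \<mu>"
    and cont: "\<And>y e. y \<in> K \<Longrightarrow> e > 0 \<Longrightarrow> \<exists>A\<in>clopens. y \<in> A \<and> (\<forall>z\<in>K \<inter> A. \<bar>f z - f y\<bar> \<le> e)"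
  shows "integrable \<mu> f" "((\<lambda>n. 1 / real (card (I n)) * (\<Sum>g\<in>I n. f (\<omega> g))) \<longlongrightarrow> integral\<^sup>L \<mu> f) G"
proof -
  have "space \<mu> = UNIV"
    using \<mu>(1) sets.sets_into_space[of UNIV \<mu>] by blast
  interpret finite_measure \<mu>
    by standard (simp add: \<open>space \<mu> = UNIV\<close> \<mu>)
  have m1: "measure \<mu> (space \<mu>) = 1"
    by (simp add: measure_def \<open>space \<mu> = UNIV\<close> \<mu>)
  interpret C: algebra UNIV "clopens :: 'a set set"
    by (rule algebra_clopens)
  have step: "\<exists>h. integrable \<mu> h \<and> (\<forall>y\<in>K. \<bar>f y - h y\<bar> \<le> e) \<and>
      ((\<lambda>n. 1 / real (card (I n)) * (\<Sum>g\<in>I n. h (\<omega> g))) \<longlongrightarrow> integral\<^sup>L \<mu> h) G" if "e > 0" for e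
  proof -
    obtain A where A: "\<And>y. y \<in> K \<Longrightarrow> A y \<in> clopens" "\<And>y. y \<in> K \<Longrightarrow> y \<in> A y"
      "\<And>y z. y \<in> K \<Longrightarrow> z \<in> K \<Longrightarrow> z \<in> A y \<Longrightarrow> \<bar>f z - f y\<bar> \<le> e"
      using cont[OF _ \<open>e > 0\<close>] by (metis IntI)
    have "compact K"
      using compact_Int_closed[OF cpt K(1)] by simp
    then obtain Y where Y: "Y \<subseteq> K" "finite Y" "K \<subseteq> (\<Union>y\<in>Y. A y)"
      by (rule compactE_image[of K K A]) (use A in blast)+
    obtain r :: nat and p where p: "Y = p ` {..<r}"
      using Y(2) by (metis finite_imp_nat_seg_image_inj_on lessThan_def)
    \<comment> \<open>Making the finite cover disjoint keeps each piece clopen and inside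
      \<open>A (p j)\<close>, so on \<open>K\<close> the value \<open>f (p j)\<close> is within
      \<open>e\<close> of \<open>f\<close> throughout the piece.\<close>
    define B where "B = disjointed (\<lambda>j. A (p j))"
    have B: "B j \<in> clopens" if "j < r" for j
    proof -
      have "(\<Union>i\<in>{0..<j}. A (p i)) \<in> clopens"
        using that A(1) Y(1) p by (intro C.finite_UN) (auto simp: subset_iff)
      then show ?thesis
        unfolding B_def disjointed_def using that A(1)[of "p j"] Y(1) p by (intro C.Diff) auto
    qed
    then have int_B: "integrable \<mu> (indicator (B j) :: 'a \<Rightarrow> real)" if "j < r" for j
      using \<mu>(1) that by (intro integrable_real_indicator) (auto simp: less_top[symmetric])
    define h where "h = (\<lambda>y. \<Sum>j<r. f (p j) * indicator (B j) y)"
    have "integrable \<mu> h"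
      unfolding h_def by (intro Bochner_Integration.integrable_sum integrable_mult_right int_B) simp
    moreover have "\<bar>f y - h y\<bar> \<le> e" if "y \<in> K" for y
    proof -
      have "y \<in> (\<Union>j\<in>{0..<r}. A (p j))"
        using that Y(3) p by (auto simp: atLeast0LessThan)
      also have "\<dots> = (\<Union>j\<in>{0..<r}. B j)"
        unfolding B_def by (simp add: UN_disjointed_eq finite_UN_disjointed_eq)
      finally obtain j where j: "j < r" "y \<in> B j"
        by auto
      have "indicator (B i) y = (if i = j then 1 else 0 :: real)" for i
        using j disjoint_family_disjointed[of "\<lambda>j. A (p j)"]
        by (auto simp: B_def[symmetric] disjoint_family_on_def indicator_def)
      then have "f (p i) * indicator (B i) y = (if i = j then f (p i) else 0)" for i
        by (metis mult_1_right mult_zero_right)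
      then have "h y = (\<Sum>i<r. if i = j then f (p i) else 0)"
        by (simp only: h_def)
      then have "h y = f (p j)"
        using j(1) by simp
      moreover have "y \<in> A (p j)"
        using j(2) by (auto simp: B_def disjointed_def)
      ultimately show ?thesis
        using A(3)[of "p j" y] that j(1) p Y(1) by auto
    qed
    moreover have "((\<lambda>n. 1 / real (card (I n)) * (\<Sum>g\<in>I n. h (\<omega> g))) \<longlongrightarrow> integral\<^sup>L \<mu> h) G"
    proof -
      have "integral\<^sup>L \<mu> h = (\<Sum>j<r. f (p j) * measure \<mu> (B j))"
        unfolding h_def using int_B
        by (subst Bochner_Integration.integral_sum) (auto simp: \<open>space \<mu> = UNIV\<close>)
      moreover have "1 / real (card (I n)) * (\<Sum>g\<in>I n. h (\<omega> g))
          = (\<Sum>j<r. f (p j) * (real (card {g\<in>I n. \<omega> g \<in> B j}) / real (card (I n))))" for n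
      proof -
        have "(\<Sum>g\<in>I n. h (\<omega> g)) = (\<Sum>j<r. f (p j) * (\<Sum>g\<in>I n. indicator (B j) (\<omega> g)))"
          unfolding h_def by (subst sum.swap) (simp add: sum_distrib_left)
        moreover have "(\<Sum>g\<in>I n. indicator (B j) (\<omega> g)) = real (card {g\<in>I n. \<omega> g \<in> B j})" for j
          by (simp add: indicator_def sum.If_cases fin Int_def Collect_conj_eq[symmetric])
        ultimately show ?thesis
          by (simp add: sum_distrib_left algebra_simps)
      qed
      ultimately show ?thesis
        by (simp only:) (intro tendsto_sum tendsto_mult tendsto_const conv B, simp)
    qed
    ultimately show ?thesis by blast
  qed
  show int: "integrable \<mu> f"
  proof -
    obtain h where h: "integrable \<mu> h" "\<forall>y\<in>K. \<bar>f y - h y\<bar> \<le> 1"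
      using step[of 1] by auto
    show ?thesis
    proof (rule Bochner_Integration.integrable_bound)
      show "integrable \<mu> (\<lambda>y. \<bar>h y\<bar> + 1)"
        using h(1) by auto
      show "AE y in \<mu>. norm (f y) \<le> norm (\<bar>h y\<bar> + 1)"
        using K(3) by eventually_elim (use h(2) in force)
    qed fact
  qed
  show "((\<lambda>n. 1 / real (card (I n)) * (\<Sum>g\<in>I n. f (\<omega> g))) \<longlongrightarrow> integral\<^sup>L \<mu> f) G"
  proof (rule tendstoI)
    fix e :: real assume "e > 0"
    then obtain h where h: "integrable \<mu> h" "\<forall>y\<in>K. \<bar>f y - h y\<bar> \<le> e/4" and
      lim: "((\<lambda>n. 1 / real (card (I n)) * (\<Sum>g\<in>I n. h (\<omega> g))) \<longlongrightarrow> integral\<^sup>L \<mu> h) G"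
      using step[of "e/4"] by auto
    have "\<bar>integral\<^sup>L \<mu> f - integral\<^sup>L \<mu> h\<bar> = \<bar>\<integral>y. f y - h y \<partial>\<mu>\<bar>"
      using int h(1) by simp
    also have "\<dots> \<le> (\<integral>y. \<bar>f y - h y\<bar> \<partial>\<mu>)"
      by (rule integral_abs_bound)
    also have "\<dots> \<le> (\<integral>y. e/4 \<partial>\<mu>)"
      by (rule integral_mono_AE) (use int h K(3) in \<open>auto elim!: eventually_mono\<close>)
    also have "\<dots> = e/4"
      by (simp add: m1)
    finally have 1: "\<bar>integral\<^sup>L \<mu> f - integral\<^sup>L \<mu> h\<bar> \<le> e/4" .
    show "\<forall>\<^sub>F n in G. dist (1 / real (card (I n)) * (\<Sum>g\<in>I n. f (\<omega> g))) (integral\<^sup>L \<mu> f) < e"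
      using tendstoD[OF lim, of "e/4"]
    proof (rule eventually_mono)
      fix n assume "dist (1 / real (card (I n)) * (\<Sum>g\<in>I n. h (\<omega> g))) (integral\<^sup>L \<mu> h) < e/4"
      moreover have "\<bar>1 / real (card (I n)) * (\<Sum>g\<in>I n. f (\<omega> g)) - 1 / real (card (I n)) * (\<Sum>g\<in>I n. h (\<omega> g))\<bar> \<le> e/4"
        by (rule average_diff_le) (use h(2) K(2) \<open>e > 0\<close> in auto)
      ultimately show "dist (1 / real (card (I n)) * (\<Sum>g\<in>I n. f (\<omega> g))) (integral\<^sup>L \<mu> f) < e"
        using 1 \<open>e > 0\<close> unfolding dist_real_def by linarith
    qed (use \<open>e > 0\<close> in simp)
  qed
qed

section \<open>Invariance from the Folner condition\<close>

text \<open>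
  Left multiplication need not be injective on \<open>I n\<close>. The image only bounds the number of
  \<open>h\<close> with \<open>P (g * h)\<close> from below; the upper bound is the lower bound for the negation of \<open>P\<close>.
\<close>

lemma folner_average_invariant:
  fixes I :: "nat \<Rightarrow> 'g::semigroup_mult set"
  assumes "folner_sequence I"
  shows "(\<lambda>n. real (card {h\<in>I n. P (g * h)}) / real (card (I n)) - real (card {h\<in>I n. P h}) / real (card (I n))) \<longlonglongrightarrow> 0"
proof -
  have fin: "finite (I n)" for n
    using assms by (simp add: folner_sequence_def)
  have le: "card {h\<in>I n. P h} \<le> card {h\<in>I n. P (g * h)} + card (sym_diff (I n) ((\<lambda>h. g * h) ` I n))" for P n
  proof -
    \<comment> \<open>An element of \<open>I n\<close> either is \<open>g * h\<close> for some
      \<open>h\<close> in \<open>I n\<close> or lies in the symmetric difference.\<close>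
    have "{h\<in>I n. P h} \<subseteq> (\<lambda>h. g * h) ` {h\<in>I n. P (g * h)} \<union> sym_diff (I n) ((\<lambda>h. g * h) ` I n)"
      by auto
    then have "card {h\<in>I n. P h} \<le> card ((\<lambda>h. g * h) ` {h\<in>I n. P (g * h)} \<union> sym_diff (I n) ((\<lambda>h. g * h) ` I n))"
      by (rule card_mono[rotated]) (simp add: fin)
    also have "\<dots> \<le> card ((\<lambda>h. g * h) ` {h\<in>I n. P (g * h)}) + card (sym_diff (I n) ((\<lambda>h. g * h) ` I n))"
      by (rule card_Un_le)
    also have "card ((\<lambda>h. g * h) ` {h\<in>I n. P (g * h)}) \<le> card {h\<in>I n. P (g * h)}"
      by (rule card_image_le) (simp add: fin)
    finally show ?thesis by simp
  qed
  have compl: "card {h\<in>I n. \<not> Q h} = card (I n) - card {h\<in>I n. Q h}" "card {h\<in>I n. Q h} \<le> card (I n)" for Q n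
  proof -
    have "{h\<in>I n. \<not> Q h} = I n - {h\<in>I n. Q h}" by auto
    then show "card {h\<in>I n. \<not> Q h} = card (I n) - card {h\<in>I n. Q h}"
      by (simp add: card_Diff_subset fin)
  qed (auto intro: card_mono fin)
  have bound: "\<bar>real (card {h\<in>I n. P (g * h)}) - real (card {h\<in>I n. P h})\<bar> \<le> real (card (sym_diff (I n) ((\<lambda>h. g * h) ` I n)))" for n
    using le[of n P] le[of n "\<lambda>h. \<not> P h"] compl(2)[of n P] compl(2)[of n "\<lambda>h. P (g * h)"]
    unfolding compl(1) by linarith
  show ?thesis
  proof (rule LIMSEQ_I)
    fix e :: real assume "e > 0"
    then obtain M where M: "\<And>n. n \<ge> M \<Longrightarrow> real (card (sym_diff (I n) ((\<lambda>h. g * h) ` I n))) / real (card (I n)) < e"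
      using assms unfolding folner_sequence_def by metis
    have "\<bar>real (card {h\<in>I n. P (g * h)}) / real (card (I n)) - real (card {h\<in>I n. P h}) / real (card (I n))\<bar> < e" if "n \<ge> M" for n
    proof -
      have "\<bar>real (card {h\<in>I n. P (g * h)}) / real (card (I n)) - real (card {h\<in>I n. P h}) / real (card (I n))\<bar>
         = \<bar>real (card {h\<in>I n. P (g * h)}) - real (card {h\<in>I n. P h})\<bar> / real (card (I n))"
        by (simp add: diff_divide_distrib[symmetric])
      also have "\<dots> \<le> real (card (sym_diff (I n) ((\<lambda>h. g * h) ` I n))) / real (card (I n))"
        by (rule divide_right_mono[OF bound]) simp
      also have "\<dots> < e" by (rule M[OF that])
      finally show ?thesis .
    qed
    then show "\<exists>no. \<forall>n\<ge>no. norm (real (card {h\<in>I n. P (g * h)}) / real (card (I n)) - real (card {h\<in>I n. P h}) / real (card (I n)) - 0) < e"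
      by auto
  qed
qed

section \<open>Decoding\<close>

lemma compact_bool_cube: "compact (UNIV :: ('a \<Rightarrow> bool) set)"
proof -
  have "compactin (product_topology (\<lambda>_. euclidean) UNIV) (PiE UNIV (\<lambda>_::'a. UNIV :: bool set))"
    unfolding compactin_PiE by (simp add: finite_imp_compact)
  then show ?thesis
    by (simp add: euclidean_product_topology)
qed

lemma clopen_vimage:
  assumes "continuous_on UNIV f" "A \<in> clopens"
  shows "f -` A \<in> clopens"
  using assms by (auto intro: open_vimage closed_vimage)

lemma clopen_coordinate: "{y :: 'a \<Rightarrow> bool. y p} \<in> clopens"
  using clopen_vimage[of "\<lambda>y. y p" "{True}"]
  by (auto simp: vimage_def open_discrete)

lemma clopen_finite_coordinates:
  assumes "finite F"
  shows "{y :: 'a \<Rightarrow> bool. \<forall>n\<in>F. y (q n) = B n} \<in> clopens"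
proof -
  interpret algebra UNIV "clopens :: ('a \<Rightarrow> bool) set set"
    by (rule algebra_clopens)
  have "{y :: 'a \<Rightarrow> bool. y (q n) = B n} \<in> clopens" for n
    using clopen_coordinate[of "q n"] compl_sets[OF clopen_coordinate, of "q n"]
    by (cases "B n") (simp_all add: Compl_eq_Diff_UNIV[symmetric] Collect_neg_eq)
  then show ?thesis
    using sets_Collect_finite_All[OF _ assms, of "\<lambda>n y. y (q n) = B n"] by simp
qed

section \<open>Codes of points and their measurable decoding\<close>

locale compact_base =
  fixes U :: "nat \<Rightarrow> 'x::topological_space set"
  assumes cpt: "compact (UNIV :: 'x set)"
    and open_U: "open (U n)"
    and base: "open W \<Longrightarrow> x \<in> W \<Longrightarrow> \<exists>n. x \<in> U n \<and> U n \<subseteq> W"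
begin

definition code :: "'x \<Rightarrow> nat \<Rightarrow> bool" where
  "code x n \<longleftrightarrow> x \<in> U n"

text \<open>Membership in the closure of the set of codes.\<close>

definition realizable :: "(nat \<Rightarrow> bool) \<Rightarrow> bool" where
  "realizable b \<longleftrightarrow> (\<forall>N. \<exists>x. \<forall>n<N. b n = code x n)"

text \<open>
  The initial candidates for decoding \<open>b\<close> are the points all of whose basic neighbourhoods are
  marked true in \<open>b\<close>. They are thinned out by removing \<open>U 0\<close>, \<open>U 1\<close> and so on in turn, whenever
  this leaves something. The survivors are topologically indistinguishable, so the choice among
  them does not affect measurability.
\<close>

primrec candidates :: "(nat \<Rightarrow> bool) \<Rightarrow> nat \<Rightarrow> 'x set" where
  "candidates b 0 = UNIV - (\<Union>m\<in>{m. \<not> b m}. U m)"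
| "candidates b (Suc n) =
     (if candidates b n \<subseteq> U n then candidates b n else candidates b n - U n)"

definition decode :: "(nat \<Rightarrow> bool) \<Rightarrow> 'x" where
  "decode b = (SOME x. x \<in> (\<Inter>n. candidates b n))"

text \<open>Compactness reduces the inclusion to a finite subcover. Each \<open>F\<close> tests
  finitely many coordinates of \<open>b\<close>, and there are countably many \<open>F\<close>,
  which makes the inclusion a measurable condition on \<open>b\<close>.\<close>

lemma candidates_0_subset_iff:
  assumes "open V"
  shows "candidates b 0 \<subseteq> V \<longleftrightarrow> (\<exists>F. finite F \<and> V \<union> (\<Union>m\<in>F. U m) = UNIV \<and> (\<forall>m\<in>F. \<not> b m))"
proof
  assume sub: "candidates b 0 \<subseteq> V"
  let ?C = "insert V (U ` {m. \<not> b m})"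
  have "UNIV \<subseteq> \<Union>?C" "\<forall>B\<in>?C. open B"
    using sub assms open_U by auto
  then obtain D where D: "D \<subseteq> ?C" "finite D" "UNIV \<subseteq> \<Union>D"
    using cpt[unfolded compact_eq_Heine_Borel] by meson
  have "D - {V} \<subseteq> U ` {m. \<not> b m}"
    using D(1) by auto
  then obtain F where F: "finite F" "F \<subseteq> {m. \<not> b m}" "D - {V} = U ` F"
    using D(2) finite_subset_image[of "D - {V}" U] by (metis finite_Diff)
  have "UNIV \<subseteq> V \<union> \<Union>(D - {V})"
    using D(3) by auto
  then have "V \<union> (\<Union>m\<in>F. U m) = UNIV"
    using F(3) by auto
  then show "\<exists>F. finite F \<and> V \<union> (\<Union>m\<in>F. U m) = UNIV \<and> (\<forall>m\<in>F. \<not> b m)"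
    using F by auto
qed auto

lemma candidates_subset_measurable:
  assumes b: "\<And>m. {y\<in>space M. b y m} \<in> sets M" and "open V"
  shows "{y\<in>space M. candidates (b y) n \<subseteq> V} \<in> sets M"
  using \<open>open V\<close>
\<comment> \<open>\<open>V\<close> must vary: when \<open>U n\<close> is removed, the inclusion in
  \<open>V\<close> becomes an inclusion of the previous stage in
  \<open>V \<union> U n\<close>.\<close>
proof (induction n arbitrary: V)
  case 0
  let ?\<F> = "{F. finite F \<and> V \<union> (\<Union>m\<in>F. U m) = UNIV}"
  have "{y\<in>space M. candidates (b y) 0 \<subseteq> V} = (\<Union>F\<in>?\<F>. {y\<in>space M. \<forall>m\<in>F. \<not> b y m})"
    unfolding candidates_0_subset_iff[OF 0] by auto
  moreover have "countable ?\<F>"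
    by (rule countable_subset[OF _ countable_Collect_finite]) auto
  ultimately show ?case
    by (auto intro!: sets.countable_UN' sets.sets_Collect_finite_All sets.sets_Collect_neg b)
next
  case (Suc n)
  have "candidates (b y) (Suc n) \<subseteq> V \<longleftrightarrow>
      (candidates (b y) n \<subseteq> U n \<and> candidates (b y) n \<subseteq> V) \<or>
      (\<not> candidates (b y) n \<subseteq> U n \<and> candidates (b y) n \<subseteq> V \<union> U n)" for y
    by auto
  then show ?case
    unfolding mem_Collect_eq
    by (simp only:) (intro sets.sets_Collect_disj sets.sets_Collect_conj sets.sets_Collect_neg Suc.IH Suc.prems open_U open_Un)
qed

lemma candidates_decseq: "decseq (candidates b)"
  by (rule decseq_SucI) auto

lemma candidates_nonempty: "candidates b 0 \<noteq> {} \<Longrightarrow> candidates b n \<noteq> {}"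
  by (induction n) auto

lemma candidates_closed: "closed (candidates b n)"
  by (induction n) (auto intro!: closed_Diff open_UN open_U simp del: Diff_eq)

text \<open>Nested nonempty closed sets in a compact space have a common point, so the choice in
  \<open>decode\<close> is genuine.\<close>

lemma decode_in_candidates:
  assumes "candidates b 0 \<noteq> {}"
  shows "decode b \<in> candidates b n"
proof -
  have "UNIV \<inter> (\<Inter>n\<in>UNIV. candidates b n) \<noteq> {}"
  proof (rule compact_imp_fip_image[OF cpt candidates_closed])
    fix J :: "nat set" assume "finite J"
    then obtain N where "\<forall>j\<in>J. j \<le> N"
      by (meson finite_nat_set_iff_bounded_le)
    then have "candidates b N \<subseteq> (\<Inter>j\<in>J. candidates b j)"
      using candidates_decseq[of b] by (auto simp: decseq_def)
    then show "UNIV \<inter> (\<Inter>j\<in>J. candidates b j) \<noteq> {}"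
      using candidates_nonempty[OF assms, of N] by auto
  qed
  then have "decode b \<in> (\<Inter>n. candidates b n)"
    unfolding decode_def by (metis Int_UNIV_left some_in_eq)
  then show ?thesis by blast
qed

text \<open>Stage \<open>n\<close> settles \<open>U n\<close>: afterwards all candidates lie in it
  or all avoid it. Membership of a chosen point thus becomes an inclusion that does not mention the
  choice.\<close>

lemma decode_mem_iff:
  assumes "candidates b 0 \<noteq> {}"
  shows "decode b \<in> U n \<longleftrightarrow> candidates b n \<subseteq> U n"
  using decode_in_candidates[OF assms, of n] decode_in_candidates[OF assms, of "Suc n"]
  by (auto split: if_splits)

lemma decode_empty:
  assumes "candidates b 0 = {}"
  shows "decode b = (SOME x. False)"
  unfolding decode_def using assms by (metis INT_E UNIV_I empty_iff)

lemma decode_measurable: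
  assumes b: "\<And>m. {y\<in>space M. b y m} \<in> sets M"
  shows "(\<lambda>y. decode (b y)) \<in> borel_measurable M"
proof (rule borel_measurableI)
  fix W :: "'x set" assume "open W"
  \<comment> \<open>All codes without candidates are decoded to one default point, and
    \<open>?c n\<close> records whether it lies in \<open>U n\<close>. Having no candidates is
    itself an inclusion in the open set \<open>{}\<close>.\<close>
  let ?c = "\<lambda>n. (SOME x. False) \<in> U n"
  have "decode b \<in> U n \<longleftrightarrow>
      (\<not> candidates b 0 \<subseteq> {} \<and> candidates b n \<subseteq> U n) \<or> (candidates b 0 \<subseteq> {} \<and> ?c n)" for b n
    using decode_mem_iff decode_empty by (cases "candidates b 0 = {}") auto
  then have *: "{y\<in>space M. decode (b y) \<in> U n} \<in> sets M" for n
    by (simp only:) (intro sets.sets_Collect_disj sets.sets_Collect_conj sets.sets_Collect_neg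
      candidates_subset_measurable b open_U open_empty sets.sets_Collect_const)
  have "W = (\<Union>n\<in>{n. U n \<subseteq> W}. U n)"
    using base[OF \<open>open W\<close>] by blast
  then have "(\<lambda>y. decode (b y)) -` W \<inter> space M = (\<Union>n\<in>{n. U n \<subseteq> W}. {y\<in>space M. decode (b y) \<in> U n})"
    by blast
  also have "\<dots> \<in> sets M"
    using * by auto
  finally show "(\<lambda>y. decode (b y)) -` W \<inter> space M \<in> sets M" .
qed

lemma realizable_code: "realizable (code x)"
  by (auto simp: realizable_def)

text \<open>Otherwise finitely many basic sets marked false would cover the space, while a point
  whose code agrees with \<open>b\<close> at their indices lies in none of them.\<close>

lemma realizable_candidates:
  assumes "realizable b"
  shows "candidates b 0 \<noteq> {}"
proof
  assume "candidates b 0 = {}"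
  then obtain F where F: "finite F" "(\<Union>m\<in>F. U m) = UNIV" "\<forall>m\<in>F. \<not> b m"
    using candidates_0_subset_iff[OF open_empty, of b] by auto
  obtain N where N: "\<forall>m\<in>F. m < N"
    using F(1) by (meson finite_nat_set_iff_bounded)
  obtain x where "\<forall>n<N. b n = code x n"
    using assms unfolding realizable_def by blast
  then show False
    using F N by (auto simp: code_def set_eq_iff)
qed

text \<open>For \<open>b = code x\<close> this says that every basic neighbourhood of the decoded
  point contains \<open>x\<close>. The converse can fail.\<close>

lemma decode_mem_imp:
  assumes "realizable b" "decode b \<in> U n"
  shows "b n"
  using decode_in_candidates[OF realizable_candidates[OF assms(1)], of 0] assms(2) by auto

section \<open>Continuous functions on finite powers of the space\<close>

context
  fixes k :: nat and u :: "(nat \<Rightarrow> 'x) \<Rightarrow> real"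
  assumes u: "continuous_map (product_topology (\<lambda>_. euclidean) {..<k}) euclideanreal u"
begin

lemma box_subset_vimage:
  assumes "open W" "u (restrict x {..<k}) \<in> W"
  obtains n where "\<And>i. i < k \<Longrightarrow> x i \<in> U (n i)"
    "\<And>z. (\<And>i. i < k \<Longrightarrow> z i \<in> U (n i)) \<Longrightarrow> u (restrict z {..<k}) \<in> W"
proof -
  have "openin (product_topology (\<lambda>_. euclidean) {..<k}) {x \<in> PiE {..<k} (\<lambda>_. UNIV). u x \<in> W}"
    using openin_continuous_map_preimage[OF u, of W] assms(1) by simp
  moreover have "restrict x {..<k} \<in> {x \<in> PiE {..<k} (\<lambda>_. UNIV). u x \<in> W}"
    using assms(2) by simp
  ultimately have "\<exists>V. finite {i \<in> {..<k}. V i \<noteq> topspace euclidean} \<and> (\<forall>i\<in>{..<k}. openin euclidean (V i)) \<and>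
      restrict x {..<k} \<in> PiE {..<k} V \<and> PiE {..<k} V \<subseteq> {x \<in> PiE {..<k} (\<lambda>_. UNIV). u x \<in> W}"
    by (rule bspec[OF iffD1[OF openin_product_topology_alt]])
  then obtain V where "\<forall>i\<in>{..<k}. openin euclidean (V i)" and
    V: "restrict x {..<k} \<in> PiE {..<k} V" "PiE {..<k} V \<subseteq> {x \<in> PiE {..<k} (\<lambda>_. UNIV). u x \<in> W}"
    by (elim exE conjE)
  then have open_V: "open (V i)" if "i < k" for i
    using that by simp
  have "\<exists>n. x i \<in> U n \<and> U n \<subseteq> V i" if "i < k" for i
    using base[OF open_V[OF that], of "x i"] V(1) that by (auto simp: PiE_iff)
  then obtain n where n: "\<And>i. i < k \<Longrightarrow> x i \<in> U (n i) \<and> U (n i) \<subseteq> V i"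
    by metis
  have "u (restrict z {..<k}) \<in> W" if "\<And>i. i < k \<Longrightarrow> z i \<in> U (n i)" for z
  proof -
    have "restrict z {..<k} \<in> PiE {..<k} V"
      using n that by auto
    then show ?thesis
      using V(2) by blast
  qed
  with n show thesis
    using that by blast
qed

lemma box_approx:
  assumes "e > 0"
  obtains n where "\<And>i. i < k \<Longrightarrow> x i \<in> U (n i)"
    "\<And>z. (\<And>i. i < k \<Longrightarrow> z i \<in> U (n i)) \<Longrightarrow> \<bar>u (restrict z {..<k}) - u (restrict x {..<k})\<bar> < e"
proof (rule box_subset_vimage[of "ball (u (restrict x {..<k})) e" x])
  fix n
  assume n: "\<And>i. i < k \<Longrightarrow> x i \<in> U (n i)"
    "\<And>z. (\<And>i. i < k \<Longrightarrow> z i \<in> U (n i)) \<Longrightarrow> u (restrict z {..<k}) \<in> ball (u (restrict x {..<k})) e"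
  show thesis
    by (rule that[of n, OF n(1)]) (use n(2) in \<open>auto simp: dist_real_def abs_minus_commute\<close>)
qed (use assms in auto)

text \<open>Every basic box around the decoded tuple contains \<open>x\<close>. If the two values of
  \<open>u\<close> differed, a box on which \<open>u\<close> varies by less than their difference
  would give a contradiction.\<close>

lemma decode_code:
  "u (\<lambda>i\<in>{..<k}. decode (code (x i))) = u (\<lambda>i\<in>{..<k}. x i)"
proof (rule ccontr)
  assume "u (\<lambda>i\<in>{..<k}. decode (code (x i))) \<noteq> u (\<lambda>i\<in>{..<k}. x i)"
  then have "\<bar>u (\<lambda>i\<in>{..<k}. x i) - u (\<lambda>i\<in>{..<k}. decode (code (x i)))\<bar> > 0" (is "?e > 0")
    by simp
  then obtain n where n: "\<And>i. i < k \<Longrightarrow> decode (code (x i)) \<in> U (n i)"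
    "\<And>z. (\<And>i. i < k \<Longrightarrow> z i \<in> U (n i)) \<Longrightarrow> \<bar>u (restrict z {..<k}) - u (\<lambda>i\<in>{..<k}. decode (code (x i)))\<bar> < ?e"
    using box_approx[of ?e "\<lambda>i. decode (code (x i))"] by metis
  from n(2)[of x] show False
    using decode_mem_imp[OF realizable_code n(1)] by (auto simp: code_def)
qed

text \<open>\<open>decode (c i)\<close> need not lie in \<open>U (n i)\<close>. Realizability of
  \<open>c i\<close> instead provides a point \<open>z i\<close> common to \<open>U (n i)\<close>
  and a small neighbourhood of \<open>decode (c i)\<close>, and \<open>u\<close> at \<open>z\<close>
  is within \<open>e/2\<close> of both values.\<close>

lemma decode_approx:
  assumes b: "\<And>i. i < k \<Longrightarrow> realizable (b i)" and "e > 0"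
  obtains n where "\<And>i. i < k \<Longrightarrow> b i (n i)"
    "\<And>c. (\<And>i. i < k \<Longrightarrow> realizable (c i)) \<Longrightarrow> (\<And>i. i < k \<Longrightarrow> c i (n i)) \<Longrightarrow>
      \<bar>u (\<lambda>i\<in>{..<k}. decode (c i)) - u (\<lambda>i\<in>{..<k}. decode (b i))\<bar> \<le> e"
proof -
  have e: "e/2 > 0" using \<open>e > 0\<close> by simp
  obtain n where n: "\<And>i. i < k \<Longrightarrow> decode (b i) \<in> U (n i)"
    "\<And>z. (\<And>i. i < k \<Longrightarrow> z i \<in> U (n i)) \<Longrightarrow> \<bar>u (restrict z {..<k}) - u (\<lambda>i\<in>{..<k}. decode (b i))\<bar> < e/2"
    using box_approx[OF e, of "\<lambda>i. decode (b i)"] by metis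
  have "\<bar>u (\<lambda>i\<in>{..<k}. decode (c i)) - u (\<lambda>i\<in>{..<k}. decode (b i))\<bar> \<le> e"
    if c: "\<And>i. i < k \<Longrightarrow> realizable (c i)" and cn: "\<And>i. i < k \<Longrightarrow> c i (n i)" for c
  proof -
    obtain n' where n': "\<And>i. i < k \<Longrightarrow> decode (c i) \<in> U (n' i)"
      "\<And>z. (\<And>i. i < k \<Longrightarrow> z i \<in> U (n' i)) \<Longrightarrow> \<bar>u (restrict z {..<k}) - u (\<lambda>i\<in>{..<k}. decode (c i))\<bar> < e/2"
      using box_approx[OF e, of "\<lambda>i. decode (c i)"] by metis
    have "\<exists>z. z \<in> U (n i) \<and> z \<in> U (n' i)" if i: "i < k" for i
    proof -
      have "c i (n' i)"
        using decode_mem_imp[OF c n'(1)] i by blast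
      moreover obtain z where "\<forall>m<Suc (max (n i) (n' i)). c i m = code z m"
        using c[OF i] unfolding realizable_def by blast
      ultimately show ?thesis
        using cn[OF i] unfolding code_def by (metis less_Suc_eq_le max.cobounded1 max.cobounded2)
    qed
    then obtain z where "\<And>i. i < k \<Longrightarrow> z i \<in> U (n i) \<and> z i \<in> U (n' i)"
      by metis
    then have "\<bar>u (restrict z {..<k}) - u (\<lambda>i\<in>{..<k}. decode (b i))\<bar> < e/2"
      "\<bar>u (restrict z {..<k}) - u (\<lambda>i\<in>{..<k}. decode (c i))\<bar> < e/2"
      using n(2)[of z] n'(2)[of z] by auto
    then show ?thesis by linarith
  qed
  moreover have "b i (n i)" if "i < k" for i
    using decode_mem_imp[OF b n(1)] that by blast
  ultimately show thesis
    using that by blast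
qed

text \<open>The countable base makes the preimage of an open set a countable union of basic boxes,
  so it belongs to the product sigma-algebra and not only to the Borel sets of the product.\<close>

lemma continuous_map_product_measurable:
  "u \<in> borel_measurable (PiM {..<k} (\<lambda>_. borel))"
proof (rule borel_measurableI)
  fix W :: "real set" assume W: "open W"
  let ?P = "PiM {..<k} (\<lambda>_. borel :: 'x measure)"
  \<comment> \<open>The index functions are extensional so that there are only countably many of
    them.\<close>
  let ?N = "{n \<in> PiE {..<k} (\<lambda>_. UNIV). PiE {..<k} (\<lambda>i. U (n i)) \<subseteq> u -` W}"
  have "u -` W \<inter> space ?P = (\<Union>n\<in>?N. PiE {..<k} (\<lambda>i. U (n i)))"
  proof (intro equalityI subsetI)
    fix x assume x: "x \<in> u -` W \<inter> space ?P"
    then have xP: "x \<in> PiE {..<k} (\<lambda>_. UNIV)" "u x \<in> W"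
      by (simp_all add: space_PiM)
    then have "u (restrict x {..<k}) \<in> W"
      by (simp only: PiE_restrict)
    then obtain n where n: "\<And>i. i < k \<Longrightarrow> x i \<in> U (n i)"
      "\<And>z. (\<And>i. i < k \<Longrightarrow> z i \<in> U (n i)) \<Longrightarrow> u (restrict z {..<k}) \<in> W"
      by (rule box_subset_vimage[OF W]) blast
    have "u z \<in> W" if "z \<in> PiE {..<k} (\<lambda>i. U (n i))" for z
      using n(2)[of z] that by (metis PiE_mem PiE_restrict lessThan_iff)
    moreover have box: "PiE {..<k} (\<lambda>i. U (restrict n {..<k} i)) = PiE {..<k} (\<lambda>i. U (n i))"
      by (rule PiE_cong) simp
    ultimately have "restrict n {..<k} \<in> ?N"
      by (auto simp only: mem_Collect_eq restrict_PiE_iff)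
    moreover have "x \<in> PiE {..<k} (\<lambda>i. U (restrict n {..<k} i))"
      using n(1) xP(1) by (simp only: box) (simp add: PiE_iff)
    ultimately show "x \<in> (\<Union>n\<in>?N. PiE {..<k} (\<lambda>i. U (n i)))"
      by blast
  next
    fix x assume "x \<in> (\<Union>n\<in>?N. PiE {..<k} (\<lambda>i. U (n i)))"
    then obtain n where "PiE {..<k} (\<lambda>i. U (n i)) \<subseteq> u -` W" and x: "x \<in> PiE {..<k} (\<lambda>i. U (n i))"
      by blast
    then have "u x \<in> W"
      by blast
    with x show "x \<in> u -` W \<inter> space ?P"
      by (simp add: space_PiM PiE_iff)
  qed
  moreover have "countable ?N"
    by (rule countable_subset[of _ "PiE {..<k} (\<lambda>_. UNIV)"]) (auto intro: countable_PiE)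
  ultimately show "u -` W \<inter> space ?P \<in> sets ?P"
    using open_U by (auto intro!: sets.countable_UN' sets_PiM_I_finite)
qed

end

text \<open>Only finitely many patterns of length \<open>N\<close> occur among codes; each fixes
  finitely many coordinates.\<close>

lemma clopen_realizable_upto:
  "{y. \<exists>x. \<forall>n<N. y (s, n) = code x n} \<in> clopens"
proof -
  interpret algebra UNIV "clopens :: ('a \<times> nat \<Rightarrow> bool) set set"
    by (rule algebra_clopens)
  let ?\<B> = "range (\<lambda>x. {n. n < N \<and> code x n})"
  have "?\<B> \<subseteq> Pow {..<N}" by auto
  then have "finite ?\<B>"
    by (rule finite_subset) simp
  moreover have "{y. \<exists>x. \<forall>n<N. y (s, n) = code x n} =
      (\<Union>B\<in>?\<B>. {y. \<forall>n\<in>{..<N}. y (s, n) = (n \<in> B)})"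
    by auto
  ultimately show ?thesis
    by (simp only:) (intro finite_UN clopen_finite_coordinates finite_lessThan)
qed

end

section \<open>The correspondence principle\<close>

theorem theorem2p2:
  fixes S :: "'s set"
    and act :: "'g::semigroup_mult \<Rightarrow> 's \<Rightarrow> 's"
    and E :: "'s \<Rightarrow> 'x::second_countable_topology"
    and I :: "nat \<Rightarrow> 'g set"
  assumes "countable S"
    and "semigroup_acts_on act S"
    and "compact (UNIV :: 'x set)"
    and "folner_sequence I"
  shows "\<exists>(\<nu> :: ('s \<Rightarrow> 'x) measure) (T :: 'g \<Rightarrow> ('s \<Rightarrow> 'x) \<Rightarrow> ('s \<Rightarrow> 'x)) (Et :: 's \<Rightarrow> ('s \<Rightarrow> 'x) \<Rightarrow> 'x).
    dynamical_system \<nu> T \<and>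
    (\<forall>s\<in>S. Et s \<in> borel_measurable \<nu>) \<and>
    (\<forall>g. \<forall>s\<in>S. \<forall>y\<in>space \<nu>. Et (act g s) y = Et s (T g y)) \<and>
    (\<forall>(k::nat) u s.
       continuous_map (product_topology (\<lambda>_. euclidean) {..<k}) euclideanreal u \<longrightarrow>
       (\<forall>i<k. s i \<in> S) \<longrightarrow>
       integrable \<nu> (\<lambda>y. u (\<lambda>i\<in>{..<k}. Et (s i) y)) \<and>
       liminf (\<lambda>n. ereal (orbit_average act E (I n) k u s))
         \<le> ereal (\<integral>y. u (\<lambda>i\<in>{..<k}. Et (s i) y) \<partial>\<nu>) \<and>
       ereal (\<integral>y. u (\<lambda>i\<in>{..<k}. Et (s i) y) \<partial>\<nu>)
         \<le> limsup (\<lambda>n. ereal (orbit_average act E (I n) k u s)))"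
proof -
  obtain \<B> :: "'x set set" where \<B>: "countable \<B>" "topological_basis \<B>"
    using ex_countable_basis by blast
  \<comment> \<open>Nonemptiness lets \<open>from_nat_into\<close> enumerate the base by all of
    \<open>nat\<close>, possibly with repetitions.\<close>
  have "\<B> \<noteq> {}"
    using topological_basisE[OF \<B>(2) open_UNIV UNIV_I] by blast
  define U where "U = from_nat_into \<B>"
  have range_U: "range U = \<B>"
    unfolding U_def by (rule range_from_nat_into[OF \<open>\<B> \<noteq> {}\<close> \<B>(1)])
  interpret compact_base U
  proof
    show "compact (UNIV :: 'x set)" by fact
    show "open (U n)" for n
      using \<B>(2) range_U by (metis rangeI topological_basis_open)
    show "\<exists>n. x \<in> U n \<and> U n \<subseteq> W" if "open W" "x \<in> W" for W x
      using topological_basisE[OF \<B>(2) that] range_U by (metis rangeE)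
  qed
  have act: "\<And>g s. s \<in> S \<Longrightarrow> act g s \<in> S" "\<And>g h s. s \<in> S \<Longrightarrow> act g (act h s) = act (h * g) s"
    using assms(2) by (auto simp: semigroup_acts_on_def)
  have fin: "\<And>n. finite (I n)"
    using assms(4) by (simp add: folner_sequence_def)
  have ne: "\<forall>\<^sub>F n in sequentially. I n \<noteq> {}"
    using assms(4) unfolding folner_sequence_def eventually_sequentially by (meson zero_less_one)

  \<comment> \<open>Orbit points and the invariant measure on the cube\<close>
  define \<omega> where "\<omega> h p \<longleftrightarrow> fst p \<in> S \<and> code (E (act h (fst p))) (snd p)" for h and p :: "'s \<times> nat"
  define shift where "shift g y p \<longleftrightarrow> fst p \<in> S \<and> y (act g (fst p), snd p)" for g y and p :: "'s \<times> nat"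
  \<comment> \<open>The law \<open>act h (act g s) = act (g * h) s\<close> turns the shift into left
    multiplication, which the Folner condition controls. Setting coordinates outside
    \<open>S\<close> to false makes the identity hold everywhere.\<close>
  have shift_\<omega>: "shift g (\<omega> h) = \<omega> (g * h)" for g h
    using act by (auto simp: fun_eq_iff shift_def \<omega>_def)
  have cont_shift: "continuous_on UNIV (shift g)" for g
  proof (rule continuous_on_coordinatewise_then_product)
    fix p show "continuous_on UNIV (\<lambda>y. shift g y p)"
      unfolding shift_def by (cases "fst p \<in> S") simp_all
  qed

  obtain \<mu> :: "('s \<times> nat \<Rightarrow> bool) measure" and G where
    \<mu>: "space \<mu> = UNIV" "sets \<mu> = sigma_sets UNIV clopens" "emeasure \<mu> UNIV = 1" and
    G: "G \<noteq> bot" "G \<le> sequentially" and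
    conv: "\<And>A. A \<in> clopens \<Longrightarrow>
      ((\<lambda>n. real (card {g\<in>I n. \<omega> g \<in> A}) / real (card (I n))) \<longlongrightarrow> measure \<mu> A) G"
    by (rule empirical_measures_cluster[OF compact_bool_cube fin ne, of \<omega>]) (rule that)
  interpret \<mu>: finite_measure \<mu>
    by standard (simp add: \<mu>)
  have clopen_sets: "clopens \<subseteq> sets \<mu>"
    unfolding \<mu>(2) by auto

  have shift_meas: "shift g \<in> measurable \<mu> \<mu>" for g
    using clopen_vimage[OF cont_shift] clopen_sets
    by (intro measurable_sigma_sets[OF \<mu>(2)]) (auto simp: \<mu>(1))
  \<comment> \<open>By \<open>shift_\<omega>\<close>, the frequencies of the preimage and of
    \<open>A\<close> differ by a sequence tending to zero, so their limits along \<open>G\<close>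
    agree.\<close>
  have measure_shift: "measure \<mu> (shift g -` A) = measure \<mu> A" if A: "A \<in> clopens" for g A
  proof -
    have "((\<lambda>n. real (card {h\<in>I n. \<omega> (g * h) \<in> A}) / real (card (I n))) \<longlongrightarrow> measure \<mu> (shift g -` A)) G"
      using conv[OF clopen_vimage[OF cont_shift A]] by (simp add: shift_\<omega>)
    from tendsto_diff[OF this conv[OF A]]
    have "((\<lambda>n. real (card {h\<in>I n. \<omega> (g * h) \<in> A}) / real (card (I n)) - real (card {h\<in>I n. \<omega> h \<in> A}) / real (card (I n)))
        \<longlongrightarrow> measure \<mu> (shift g -` A) - measure \<mu> A) G" .
    moreover have "((\<lambda>n. real (card {h\<in>I n. \<omega> (g * h) \<in> A}) / real (card (I n)) - real (card {h\<in>I n. \<omega> h \<in> A}) / real (card (I n)))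
        \<longlongrightarrow> 0) G"
      using folner_average_invariant[OF assms(4), of "\<lambda>h. \<omega> h \<in> A"] G(2) by (rule tendsto_mono[rotated])
    ultimately show ?thesis
      using tendsto_unique[OF G(1)] by fastforce
  qed
  have shift_inv: "distr \<mu> \<mu> (shift g) = \<mu>" for g
  proof (rule measure_eqI_generator_eq[where \<Omega>=UNIV and E=clopens and A="\<lambda>_. UNIV"])
    show "emeasure (distr \<mu> \<mu> (shift g)) A = emeasure \<mu> A" if "A \<in> clopens" for A
      using that clopen_sets shift_meas measure_shift
      by (subst emeasure_distr) (auto simp: \<mu>(1) \<mu>.emeasure_eq_measure)
  qed (auto simp: \<mu> Int_stable_def emeasure_distr[OF shift_meas])

  \<comment> \<open>Concentration of the measure on realizable codes\<close>
  define K where "K = {y. \<forall>s\<in>S. realizable (\<lambda>n. y (s, n))}"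
  have \<omega>_K: "\<omega> h \<in> K" for h
    using realizable_code by (auto simp: K_def \<omega>_def)
  define R where "R s N = {y. \<exists>x. \<forall>n<N. y (s, n) = code x n}" for s :: 's and N
  have R: "R s N \<in> clopens" for s N
    unfolding R_def by (rule clopen_realizable_upto)
  have K_eq: "K = (\<Inter>s\<in>S. \<Inter>N. R s N)"
    by (auto simp: K_def R_def realizable_def)
  have "closed K"
    unfolding K_eq using R by (intro closed_INT ballI) auto
  \<comment> \<open>The complement of \<open>A\<close> is clopen and has frequency zero for every
    \<open>n\<close>, hence measure zero.\<close>
  have AE_clopen: "AE y in \<mu>. y \<in> A" if A: "A \<in> clopens" "\<And>h. \<omega> h \<in> A" for A
  proof -
    have mA: "- A \<in> clopens"
      using A(1) by auto
    have "((\<lambda>n. 0) \<longlongrightarrow> measure \<mu> (- A)) G"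
      using conv[OF mA] A(2) by simp
    then have "measure \<mu> (- A) = 0"
      using tendsto_unique[OF G(1) _ tendsto_const] by blast
    then have "- A \<in> null_sets \<mu>"
      using mA clopen_sets by (auto simp: null_sets_def \<mu>.emeasure_eq_measure)
    then show ?thesis
      by (rule AE_I') auto
  qed
  have "\<omega> h \<in> R s N" if "s \<in> S" for h s N
    using \<omega>_K that unfolding K_eq by blast
  \<comment> \<open>Countability of \<open>S\<close> makes \<open>K\<close> an intersection of
    countably many clopen sets of full measure.\<close>
  then have "AE y in \<mu>. \<forall>s\<in>S. \<forall>N. y \<in> R s N"
    unfolding AE_ball_countable[OF assms(1)] AE_all_countable using AE_clopen[OF R] by blast
  then have AE_K: "AE y in \<mu>. y \<in> K"
    by eventually_elim (auto simp: K_eq)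

  \<comment> \<open>Transport to functions from \<open>S\<close> to the space\<close>
  define P where "P = PiM S (\<lambda>_. borel :: 'x measure)"
  define \<Delta> where "\<Delta> y = (\<lambda>s\<in>S. decode (\<lambda>n. y (s, n)))" for y
  define T where "T g w = (\<lambda>s\<in>S. w (act g s))" for g and w :: "'s \<Rightarrow> 'x"
  have coord: "{y\<in>space \<mu>. y (s, n)} \<in> sets \<mu>" for s n
    using subsetD[OF clopen_sets clopen_coordinate] by (simp add: \<mu>(1))
  have decode_meas: "(\<lambda>y. decode (\<lambda>n. y (s, n))) \<in> borel_measurable \<mu>" for s
    by (rule decode_measurable) (rule coord)
  have \<Delta>_meas: "\<Delta> \<in> measurable \<mu> P"
    unfolding P_def \<Delta>_def by (intro measurable_restrict decode_meas)
  have T_meas: "T g \<in> measurable P P" for g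
    unfolding P_def T_def by (intro measurable_restrict measurable_component_singleton act)
  \<comment> \<open>Decoding acts on each row separately, so it intertwines the shifts for every
    \<open>y\<close>, realizable or not.\<close>
  have T_\<Delta>: "T g \<circ> \<Delta> = \<Delta> \<circ> shift g" for g
    using act by (auto simp: fun_eq_iff T_def \<Delta>_def shift_def)
  define \<nu> where "\<nu> = distr \<mu> P \<Delta>"
  have sets_\<nu>: "sets \<nu> = sets P" "space \<nu> = space P"
    by (simp_all add: \<nu>_def)
  have "distr \<nu> \<nu> (T g) = \<nu>" for g
  proof -
    have "distr \<nu> \<nu> (T g) = distr \<nu> P (T g)"
      by (rule distr_cong) (simp_all add: sets_\<nu>)
    also have "\<dots> = distr \<mu> P (\<Delta> \<circ> shift g)"
      by (simp add: \<nu>_def distr_distr[OF T_meas \<Delta>_meas] T_\<Delta>)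
    also have "\<dots> = distr (distr \<mu> \<mu> (shift g)) P \<Delta>"
      by (simp add: distr_distr[OF \<Delta>_meas shift_meas])
    finally show ?thesis
      by (simp add: shift_inv \<nu>_def)
  qed
  moreover have "T g \<in> measurable \<nu> \<nu>" for g
    using T_meas by (simp add: measurable_cong_sets[OF sets_\<nu>(1) sets_\<nu>(1)])
  \<comment> \<open>Precomposition reverses the order of composition, and the law of the action
    reverses it back.\<close>
  moreover have "T g (T h y) = T (g * h) y" for g h y
    using act by (auto simp: fun_eq_iff T_def)
  ultimately have dyn: "dynamical_system \<nu> T"
    by (auto simp: dynamical_system_def)
  have meas: "(\<lambda>y. y s) \<in> borel_measurable \<nu>" if "s \<in> S" for s
    unfolding measurable_cong_sets[OF sets_\<nu>(1) refl] P_def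
    using that by (rule measurable_component_singleton)
  have equi: "y (act g s) = T g y s" if "s \<in> S" for g s y
    using that by (simp add: T_def)
  have main:
    "integrable \<nu> (\<lambda>y. u (\<lambda>i\<in>{..<k}. y (s i)))"
    "liminf (\<lambda>n. ereal (orbit_average act E (I n) k u s)) \<le> ereal (\<integral>y. u (\<lambda>i\<in>{..<k}. y (s i)) \<partial>\<nu>)"
    "ereal (\<integral>y. u (\<lambda>i\<in>{..<k}. y (s i)) \<partial>\<nu>) \<le> limsup (\<lambda>n. ereal (orbit_average act E (I n) k u s))"
    if u: "continuous_map (product_topology (\<lambda>_. euclidean) {..<k}) euclideanreal u"
      and s: "\<forall>i<k. s i \<in> S" for k u s
  proof -
    let ?v = "\<lambda>y. u (\<lambda>i\<in>{..<k}. y (s i))"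
    let ?f = "\<lambda>y. u (\<lambda>i\<in>{..<k}. decode (\<lambda>n. y (s i, n)))"
    have v\<Delta>: "?v (\<Delta> y) = ?f y" for y
      using s by (intro arg_cong[of _ _ u]) (auto simp: \<Delta>_def)
    have v_meas: "?v \<in> borel_measurable P"
      unfolding P_def using s
      by (intro measurable_compose[OF measurable_restrict continuous_map_product_measurable[OF u]]
          measurable_component_singleton) auto
    have f_meas: "?f \<in> borel_measurable \<mu>"
      using measurable_compose[OF \<Delta>_meas v_meas] by (simp only: v\<Delta>)
    \<comment> \<open>On \<open>K\<close> all rows are realizable, so \<open>decode_approx\<close>
      applies; its condition fixes \<open>k\<close> coordinates to be true, which is clopen.\<close>
    have approx: "\<exists>A\<in>clopens. y \<in> A \<and> (\<forall>z\<in>K \<inter> A. \<bar>?f z - ?f y\<bar> \<le> e)" if y: "y \<in> K" and "e > 0" for y e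
    proof -
      have re: "realizable (\<lambda>n. z (s i, n))" if "z \<in> K" "i < k" for z i
        using that s by (auto simp: K_def)
      obtain n where n: "\<And>i. i < k \<Longrightarrow> y (s i, n i)"
        "\<And>c. (\<And>i. i < k \<Longrightarrow> realizable (c i)) \<Longrightarrow> (\<And>i. i < k \<Longrightarrow> c i (n i)) \<Longrightarrow>
          \<bar>u (\<lambda>i\<in>{..<k}. decode (c i)) - ?f y\<bar> \<le> e"
        using decode_approx[OF u, of "\<lambda>i n. y (s i, n)", OF re[OF y] \<open>e > 0\<close>] by blast
      let ?A = "{y. \<forall>i\<in>{..<k}. y (s i, n i) = True}"
      have "?A \<in> clopens"
        by (rule clopen_finite_coordinates) simp
      moreover have "\<bar>?f z - ?f y\<bar> \<le> e" if "z \<in> K \<inter> ?A" for z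
        by (rule n(2)) (use that re in auto)
      ultimately show ?thesis
        using n(1) by (intro bexI[of _ ?A]) auto
    qed
    note lim = averages_tendsto_integral[OF compact_bool_cube fin clopen_sets \<mu>(3) conv \<open>closed K\<close> \<omega>_K AE_K f_meas approx]
    \<comment> \<open>The relevant rows of \<open>\<omega> g\<close> are codes of actual points, and
      \<open>u\<close> does not distinguish these points from the decoded ones.\<close>
    have "?f (\<omega> g) = u (\<lambda>i\<in>{..<k}. E (act g (s i)))" for g
    proof -
      have "(\<lambda>i\<in>{..<k}. decode (\<lambda>n. \<omega> g (s i, n))) = (\<lambda>i\<in>{..<k}. decode (code (E (act g (s i)))))"
        using s by (intro restrict_ext) (simp add: \<omega>_def)
      then show ?thesis
        by (simp only: decode_code[OF u])
    qed
    then have avg: "orbit_average act E (I n) k u s = 1 / real (card (I n)) * (\<Sum>g\<in>I n. ?f (\<omega> g))" for n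
      by (simp only: orbit_average_def)
    show "integrable \<nu> ?v"
      unfolding \<nu>_def integrable_distr_eq[OF \<Delta>_meas v_meas] v\<Delta> by (rule lim(1))
    have "integral\<^sup>L \<nu> ?v = integral\<^sup>L \<mu> ?f"
      unfolding \<nu>_def integral_distr[OF \<Delta>_meas v_meas] v\<Delta> by (rule refl)
    then have "((\<lambda>n. ereal (orbit_average act E (I n) k u s)) \<longlongrightarrow> ereal (integral\<^sup>L \<nu> ?v)) G"
      using lim(2) by (simp only: avg lim_ereal)
    \<comment> \<open>Convergence along the proper filter \<open>G\<close> makes both limits equal
      to the integral; since \<open>G\<close> refines \<open>sequentially\<close>, they lie between
      the lower and upper limits of the sequence.\<close>
    then have "Liminf G (\<lambda>n. ereal (orbit_average act E (I n) k u s)) = ereal (integral\<^sup>L \<nu> ?v)"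
      "Limsup G (\<lambda>n. ereal (orbit_average act E (I n) k u s)) = ereal (integral\<^sup>L \<nu> ?v)"
      using G(1) by (auto intro: lim_imp_Liminf lim_imp_Limsup)
    then show "liminf (\<lambda>n. ereal (orbit_average act E (I n) k u s)) \<le> ereal (integral\<^sup>L \<nu> ?v)"
      "ereal (integral\<^sup>L \<nu> ?v) \<le> limsup (\<lambda>n. ereal (orbit_average act E (I n) k u s))"
      using Liminf_antimono_filter[OF G(2), of "\<lambda>n. ereal (orbit_average act E (I n) k u s)"]
        Limsup_mono_filter[OF G(2), of "\<lambda>n. ereal (orbit_average act E (I n) k u s)"] by (simp_all only:)
  qed
  show ?thesis
  proof (rule exI[of _ \<nu>], rule exI[of _ T], rule exI[of _ "\<lambda>s y. y s"], intro conjI allI ballI impI)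
    show "dynamical_system \<nu> T" by (rule dyn)
  qed (rule meas equi main; assumption)+
qed

end
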